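(* Let $A\in\mathbb{R}^{n\times n}$ be symmetric positive definite and banded with bandwidth $\beta_A$, and let $D\in\mathbb{R}^{n\times n}$ be symmetric and banded with bandwidth $\beta_D$. Apply the matrix-oriented conjugate gradient algorithm (recalled in the context) to the Lyapunov equation $AX+XA=D$ with $X_0=0$. Then all the iterates generated by the algorithm are banded matrices and, in particular, for every iteration index $k\ge 1$, $$\beta_{W_k}\leq k\beta_{A}+\beta_{D},\qquad \beta_{X_k}\leq (k-1)\beta_{A}+\beta_{D},\qquad \beta_{R_k}\leq k\beta_{A}+\beta_{D},\qquad \beta_{P_k}\leq k\beta_{A}+\beta_{D}.$$
   Context: For a square matrix $T$, $\beta_T$ denotes its bandwidth: $(T)_{i,j}=0$ for $|i-j|>\beta_T$ (tridiagonal: $\beta_T=1$). $\langle Y,Z\rangle_F=\mathrm{trace}(Z^TY)$ and $\|Y\|_F^2=\langle Y,Y\rangle_F$. Matrix-oriented conjugate gradient algorithm for $AX+XA=D$ with starting matrix $X_0$: set $R_0=D-AX_0-X_0A$, $P_0=R_0$. For $k=1,2,\dots$: $W_k=AP_{k-1}+P_{k-1}A$; $\alpha_k=\|R_{k-1}\|_F^2/\langle P_{k-1},W_k\rangle_F$; $X_k=X_{k-1}+\alpha_kP_{k-1}$; $R_k=R_{k-1}-\alpha_kW_k$; stop if $\|R_k\|_F/\|R_0\|_F$ is below a prescribed tolerance $\epsilon_{res}>0$ (or if a maximum number of iterations is reached); otherwise $\beta_k=\|R_k\|_F^2/\|R_{k-1}\|_F^2$ (a scalar, not a bandwidth) and $P_k=R_k+\beta_kP_{k-1}$.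 *)

theory Defs
  imports "Jordan_Normal_Form.Matrix" "HOL-Library.Extended_Nat"
begin

section \<open>Banded matrices\<close>

definition has_bandwidth :: "'a::zero mat \<Rightarrow> nat \<Rightarrow> bool" where
  "has_bandwidth T b \<longleftrightarrow> square_mat T \<and>
     (\<forall>i<dim_row T. \<forall>j<dim_row T. \<bar>int i - int j\<bar> > int b \<longrightarrow> T $$ (i, j) = 0)"

text \<open>Since the dimension is fixed, every square matrix is banded for a large enough bandwidth; the
quantitative information is in \<^term>\<open>bandwidth\<close> below.\<close>

definition banded :: "'a::zero mat \<Rightarrow> bool" where
  "banded T \<longleftrightarrow> (\<exists>b. has_bandwidth T b)"

definition bandwidth :: "'a::zero mat \<Rightarrow> nat" where
  "bandwidth T = (LEAST b. has_bandwidth T b)"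

lemma has_bandwidth_mono: "has_bandwidth T b \<Longrightarrow> b \<le> c \<Longrightarrow> has_bandwidth T c"
  unfolding has_bandwidth_def by fastforce

lemma has_bandwidth_dim: "square_mat T \<Longrightarrow> has_bandwidth T (dim_row T)"
  unfolding has_bandwidth_def by auto

lemma has_bandwidth_iff_bandwidth_le:
  assumes "square_mat T"
  shows "has_bandwidth T b \<longleftrightarrow> bandwidth T \<le> b"
proof
  show "has_bandwidth T b \<Longrightarrow> bandwidth T \<le> b"
    unfolding bandwidth_def by (rule Least_le)
next
  have "has_bandwidth T (bandwidth T)"
    unfolding bandwidth_def using has_bandwidth_dim[OF assms] by (rule LeastI)
  then show "bandwidth T \<le> b \<Longrightarrow> has_bandwidth T b"
    by (rule has_bandwidth_mono)
qed


section \<open>Positive definiteness and the Frobenius inner product\<close>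

definition sym_pos_def :: "real mat \<Rightarrow> bool" where
  "sym_pos_def A \<longleftrightarrow> square_mat A \<and> transpose_mat A = A \<and>
     (\<forall>v \<in> carrier_vec (dim_row A). v \<noteq> 0\<^sub>v (dim_row A) \<longrightarrow> v \<bullet> (A *\<^sub>v v) > 0)"

definition mat_trace :: "'a::comm_monoid_add mat \<Rightarrow> 'a" where
  "mat_trace M = (\<Sum>i<dim_row M. M $$ (i, i))"

definition frob_inner :: "real mat \<Rightarrow> real mat \<Rightarrow> real" where
  "frob_inner Y Z = mat_trace (transpose_mat Z * Y)"

definition frob_norm :: "real mat \<Rightarrow> real" where
  "frob_norm Y = sqrt (frob_inner Y Y)"


section \<open>Matrix-oriented conjugate gradients for \<open>A X + X A = D\<close>\<close>

text \<open>The recurrences \<open>(X\<^sub>k, R\<^sub>k, P\<^sub>k)\<close> without the stopping test. If \<open>R\<^sub>k = 0\<close>, the formulas contain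
quotients \<open>0 / 0\<close>, which are \<open>0\<close> in HOL, so that the sequence is continued by \<open>X\<^sub>k\<close> and zero matrices.
As a zero residual passes the stopping test, no such step is performed by the algorithm, except
step 1 for \<open>R\<^sub>0 = 0\<close> (the test comes after the first step).\<close>

primrec cg_state :: "real mat \<Rightarrow> real mat \<Rightarrow> real mat \<Rightarrow> nat \<Rightarrow> real mat \<times> real mat \<times> real mat" where
  "cg_state A D X\<^sub>0 0 = (let R\<^sub>0 = D - A * X\<^sub>0 - X\<^sub>0 * A in (X\<^sub>0, R\<^sub>0, R\<^sub>0))"
| "cg_state A D X\<^sub>0 (Suc k) =
    (case cg_state A D X\<^sub>0 k of (X, R, P) \<Rightarrow>
      let W = A * P + P * A;
          \<alpha> = (frob_norm R)\<^sup>2 / frob_inner P W;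
          X' = X + \<alpha> \<cdot>\<^sub>m P;
          R' = R - \<alpha> \<cdot>\<^sub>m W;
          \<beta> = (frob_norm R')\<^sup>2 / (frob_norm R)\<^sup>2
      in (X', R', R' + \<beta> \<cdot>\<^sub>m P))"

definition cg_X :: "real mat \<Rightarrow> real mat \<Rightarrow> real mat \<Rightarrow> nat \<Rightarrow> real mat" where
  "cg_X A D X\<^sub>0 k = fst (cg_state A D X\<^sub>0 k)"

definition cg_R :: "real mat \<Rightarrow> real mat \<Rightarrow> real mat \<Rightarrow> nat \<Rightarrow> real mat" where
  "cg_R A D X\<^sub>0 k = fst (snd (cg_state A D X\<^sub>0 k))"

definition cg_P :: "real mat \<Rightarrow> real mat \<Rightarrow> real mat \<Rightarrow> nat \<Rightarrow> real mat" where
  "cg_P A D X\<^sub>0 k = snd (snd (cg_state A D X\<^sub>0 k))"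

text \<open>Only meaningful for \<open>k \<ge> 1\<close>.\<close>

definition cg_W :: "real mat \<Rightarrow> real mat \<Rightarrow> real mat \<Rightarrow> nat \<Rightarrow> real mat" where
  "cg_W A D X\<^sub>0 k = A * cg_P A D X\<^sub>0 (k - 1) + cg_P A D X\<^sub>0 (k - 1) * A"

text \<open>The bound \<open>kmax\<close> on the number of iterations may be \<open>\<infinity>\<close> (no bound).\<close>

definition cg_stops :: "real mat \<Rightarrow> real mat \<Rightarrow> real mat \<Rightarrow> real \<Rightarrow> enat \<Rightarrow> nat \<Rightarrow> bool" where
  "cg_stops A D X\<^sub>0 \<epsilon> kmax k \<longleftrightarrow>
     frob_norm (cg_R A D X\<^sub>0 k) / frob_norm (cg_R A D X\<^sub>0 0) < \<epsilon> \<or> kmax \<le> enat k"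

text \<open>Step \<open>k\<close> is performed iff the test has not succeeded in an earlier step; step 0 is the
initialisation, which has no test.\<close>

definition cg_performs :: "real mat \<Rightarrow> real mat \<Rightarrow> real mat \<Rightarrow> real \<Rightarrow> enat \<Rightarrow> nat \<Rightarrow> bool" where
  "cg_performs A D X\<^sub>0 \<epsilon> kmax k \<longleftrightarrow> (\<forall>j. 1 \<le> j \<and> j < k \<longrightarrow> \<not> cg_stops A D X\<^sub>0 \<epsilon> kmax j)"

end

theory Submission
  imports Defs
begin

text \<open>
The set of matrices with bandwidth at most \<open>b\<close> is a linear subspace, and bandwidths add up under
multiplication, because a path of two steps of lengths at most \<open>a\<close> and \<open>b\<close> moves an index by at most
\<open>a + b\<close>. Hence the Lyapunov operator \<open>Y \<mapsto> A Y + Y A\<close> widens the band by at most \<open>\<beta>\<^sub>A\<close>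
(\<open>has_bandwidth_lyapunov\<close>).

One iteration applies this operator once, to the previous direction, and otherwise forms linear
combinations only; whatever the scalars \<open>\<alpha>\<^sub>k\<close> and \<open>\<beta>\<^sub>k\<close> are, the band of \<open>R\<^sub>k\<close> and \<open>P\<^sub>k\<close> therefore
grows by at most \<open>\<beta>\<^sub>A\<close> in each step. It starts at \<open>\<beta>\<^sub>D\<close>, since \<open>X\<^sub>0 = 0\<close> gives
\<open>R\<^sub>0 = P\<^sub>0 = D\<close>. The iterate \<open>X\<^sub>k\<close> is a combination of \<open>P\<^sub>0, \<dots>, P\<^bsub>k-1\<^esub>\<close>, so its bound lags one step
behind. The argument is an induction on \<open>k\<close> over the recurrences (\<open>cg_iterates_bandwidth\<close>).
\<close>

lemma has_bandwidthI:
  assumes "T \<in> carrier_mat n n"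
    and "\<And>i j. i < n \<Longrightarrow> j < n \<Longrightarrow> int b < \<bar>int i - int j\<bar> \<Longrightarrow> T $$ (i, j) = 0"
  shows "has_bandwidth T b"
  using assms unfolding has_bandwidth_def by auto

lemma has_bandwidthD:
  assumes "has_bandwidth T b" "T \<in> carrier_mat n n" "i < n" "j < n" "int b < \<bar>int i - int j\<bar>"
  shows "T $$ (i, j) = 0"
  using assms unfolding has_bandwidth_def by auto

lemma has_bandwidth_zero: "has_bandwidth (0\<^sub>m n n) b"
  by (rule has_bandwidthI) auto

lemma has_bandwidth_add:
  fixes Y Z :: "'a::monoid_add mat"
  assumes "Y \<in> carrier_mat n n" "Z \<in> carrier_mat n n" "has_bandwidth Y b" "has_bandwidth Z b"
  shows "has_bandwidth (Y + Z) b"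
  using assms by (intro has_bandwidthI[of _ n]) (auto simp: has_bandwidthD)

lemma has_bandwidth_diff:
  fixes Y Z :: "'a::group_add mat"
  assumes "Y \<in> carrier_mat n n" "Z \<in> carrier_mat n n" "has_bandwidth Y b" "has_bandwidth Z b"
  shows "has_bandwidth (Y - Z) b"
  using assms by (intro has_bandwidthI[of _ n]) (auto simp: has_bandwidthD)

lemma has_bandwidth_smult:
  fixes Y :: "'a::mult_zero mat"
  assumes "Y \<in> carrier_mat n n" "has_bandwidth Y b"
  shows "has_bandwidth (c \<cdot>\<^sub>m Y) b"
  using assms by (intro has_bandwidthI[of _ n]) (auto simp: has_bandwidthD)

text \<open>
If \<open>\<bar>i - j\<bar> > a + b\<close>, the triangle inequality gives \<open>\<bar>i - l\<bar> > a\<close> or \<open>\<bar>l - j\<bar> > b\<close> for every \<open>l\<close>, so that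
each summand of the \<open>(i, j)\<close> entry has a factor \<open>0\<close>.
\<close>

lemma has_bandwidth_mult:
  fixes Y Z :: "'a::semiring_0 mat"
  assumes Y: "Y \<in> carrier_mat n n" "has_bandwidth Y a"
    and Z: "Z \<in> carrier_mat n n" "has_bandwidth Z b"
  shows "has_bandwidth (Y * Z) (a + b)"
proof (rule has_bandwidthI)
  show "Y * Z \<in> carrier_mat n n"
    using Y Z by simp
next
  fix i j assume ij: "i < n" "j < n" "int (a + b) < \<bar>int i - int j\<bar>"
  have "Y $$ (i, l) * Z $$ (l, j) = 0" if "l < n" for l
  proof -
    from ij(3) consider "int a < \<bar>int i - int l\<bar>" | "int b < \<bar>int l - int j\<bar>"
      by linarith
    then show ?thesis
      using has_bandwidthD[OF Y(2,1)] has_bandwidthD[OF Z(2,1)] ij(1,2) that by cases auto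
  qed
  then show "(Y * Z) $$ (i, j) = 0"
    using ij Y(1) Z(1) by (auto simp: scalar_prod_def intro!: sum.neutral)
qed

lemma has_bandwidth_lyapunov:
  fixes A Y :: "'a::semiring_0 mat"
  assumes "A \<in> carrier_mat n n" "has_bandwidth A a" "Y \<in> carrier_mat n n" "has_bandwidth Y b"
  shows "has_bandwidth (A * Y + Y * A) (a + b)"
proof (rule has_bandwidth_add)
  show "has_bandwidth (A * Y) (a + b)"
    using assms by (intro has_bandwidth_mult)
  show "has_bandwidth (Y * A) (a + b)"
    using has_bandwidth_mult[OF assms(3,4,1,2)] by (simp add: add.commute)
qed (use assms in auto)

lemma cg_0:
  "cg_X A D X\<^sub>0 0 = X\<^sub>0"
  "cg_R A D X\<^sub>0 0 = D - A * X\<^sub>0 - X\<^sub>0 * A"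
  "cg_P A D X\<^sub>0 0 = D - A * X\<^sub>0 - X\<^sub>0 * A"
  by (simp_all add: cg_X_def cg_R_def cg_P_def Let_def)

text \<open>
For the band estimate only the linear shape of an iteration matters, so the step lengths are
hidden behind an existential quantifier.
\<close>

lemma cg_Suc:
  "\<exists>\<alpha> \<beta>. cg_X A D X\<^sub>0 (Suc k) = cg_X A D X\<^sub>0 k + \<alpha> \<cdot>\<^sub>m cg_P A D X\<^sub>0 k \<and>
         cg_R A D X\<^sub>0 (Suc k) = cg_R A D X\<^sub>0 k - \<alpha> \<cdot>\<^sub>m cg_W A D X\<^sub>0 (Suc k) \<and>
         cg_P A D X\<^sub>0 (Suc k) = cg_R A D X\<^sub>0 (Suc k) + \<beta> \<cdot>\<^sub>m cg_P A D X\<^sub>0 k"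
proof -
  obtain X R P where "cg_state A D X\<^sub>0 k = (X, R, P)"
    by (metis prod.exhaust)
  then show ?thesis
    by (auto simp: cg_X_def cg_R_def cg_P_def cg_W_def Let_def)
qed

text \<open>
For \<open>k = 0\<close> the truncated difference \<open>k - 1 = 0\<close> makes the bound for \<open>X\<^sub>0 = 0\<close> equal to \<open>d\<close>, which is
a valid bound, and the right one to start from: \<open>X\<^sub>1\<close> is a multiple of \<open>P\<^sub>0 = D\<close>.
\<close>

lemma cg_iterates_bandwidth:
  assumes A: "A \<in> carrier_mat n n" "has_bandwidth A a"
    and D: "D \<in> carrier_mat n n" "has_bandwidth D d"
  defines "X \<equiv> cg_X A D (0\<^sub>m n n)" and "R \<equiv> cg_R A D (0\<^sub>m n n)" and "P \<equiv> cg_P A D (0\<^sub>m n n)"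
  shows "X k \<in> carrier_mat n n \<and> R k \<in> carrier_mat n n \<and> P k \<in> carrier_mat n n \<and>
    has_bandwidth (X k) ((k - 1) * a + d) \<and>
    has_bandwidth (R k) (k * a + d) \<and> has_bandwidth (P k) (k * a + d)"
proof (induction k)
  case 0
  have "D - A * 0\<^sub>m n n - 0\<^sub>m n n * A = D"
    using A D by (intro eq_matI) auto
  then show ?case
    using D by (simp add: X_def R_def P_def cg_0 has_bandwidth_zero)
next
  case (Suc k)
  define W where "W = A * P k + P k * A"
  obtain \<alpha> \<beta> where step:
    "X (Suc k) = X k + \<alpha> \<cdot>\<^sub>m P k"
    "R (Suc k) = R k - \<alpha> \<cdot>\<^sub>m W"
    "P (Suc k) = R (Suc k) + \<beta> \<cdot>\<^sub>m P k"
    using cg_Suc[of A D "0\<^sub>m n n" k] unfolding X_def R_def P_def W_def cg_W_def by auto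
  have carrier: "X k \<in> carrier_mat n n" "R k \<in> carrier_mat n n" "P k \<in> carrier_mat n n"
    "W \<in> carrier_mat n n"
    using Suc A by (auto simp: W_def)
  have carrier': "X (Suc k) \<in> carrier_mat n n" "R (Suc k) \<in> carrier_mat n n"
    "P (Suc k) \<in> carrier_mat n n"
    using carrier by (simp_all add: step minus_carrier_mat)
  have W: "has_bandwidth W (Suc k * a + d)"
    using has_bandwidth_lyapunov[OF A carrier(3)] Suc unfolding W_def
    by (simp add: add.assoc)
  have Xb: "has_bandwidth (X k) (k * a + d)"
    using Suc by (auto intro: has_bandwidth_mono)
  have Rb: "has_bandwidth (R k) (Suc k * a + d)" and Pb: "has_bandwidth (P k) (Suc k * a + d)"
    using Suc by (auto intro: has_bandwidth_mono)
  have "has_bandwidth (X (Suc k)) (k * a + d)"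
    unfolding step(1) using Suc Xb carrier
    by (intro has_bandwidth_add[of _ n] has_bandwidth_smult[of _ n]) auto
  moreover have R': "has_bandwidth (R (Suc k)) (Suc k * a + d)"
    unfolding step(2) using Rb W carrier
    by (intro has_bandwidth_diff[of _ n] has_bandwidth_smult[of _ n]) auto
  moreover have "has_bandwidth (P (Suc k)) (Suc k * a + d)"
    unfolding step(3) using R' Pb carrier carrier'
    by (intro has_bandwidth_add[of _ n] has_bandwidth_smult[of _ n]) auto
  ultimately show ?case
    using carrier' by simp
qed

theorem proposition2p4:
  fixes A D X\<^sub>0 :: "real mat" and n \<beta>\<^sub>A \<beta>\<^sub>D :: nat and \<epsilon> :: real and kmax :: enat
  assumes "A \<in> carrier_mat n n" and "sym_pos_def A" and "has_bandwidth A \<beta>\<^sub>A"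
    and "D \<in> carrier_mat n n" and "transpose_mat D = D" and "has_bandwidth D \<beta>\<^sub>D"
    and "X\<^sub>0 = 0\<^sub>m n n" and "\<epsilon> > 0"
  shows "(\<forall>k. cg_performs A D X\<^sub>0 \<epsilon> kmax k \<longrightarrow>
            banded (cg_X A D X\<^sub>0 k) \<and> banded (cg_R A D X\<^sub>0 k) \<and> banded (cg_P A D X\<^sub>0 k) \<and>
            (k \<ge> 1 \<longrightarrow> banded (cg_W A D X\<^sub>0 k))) \<and>
         (\<forall>k\<ge>1. cg_performs A D X\<^sub>0 \<epsilon> kmax k \<longrightarrow>
            bandwidth (cg_W A D X\<^sub>0 k) \<le> k * \<beta>\<^sub>A + \<beta>\<^sub>D \<and>
            bandwidth (cg_X A D X\<^sub>0 k) \<le> (k - 1) * \<beta>\<^sub>A + \<beta>\<^sub>D \<and>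
            bandwidth (cg_R A D X\<^sub>0 k) \<le> k * \<beta>\<^sub>A + \<beta>\<^sub>D \<and>
            bandwidth (cg_P A D X\<^sub>0 k) \<le> k * \<beta>\<^sub>A + \<beta>\<^sub>D)"
proof -
  note iterates = cg_iterates_bandwidth[OF assms(1,3,4,6), folded assms(7)]
  have W: "has_bandwidth (cg_W A D X\<^sub>0 k) (k * \<beta>\<^sub>A + \<beta>\<^sub>D)" if "k \<ge> 1" for k
  proof -
    have "\<beta>\<^sub>A + ((k - 1) * \<beta>\<^sub>A + \<beta>\<^sub>D) = k * \<beta>\<^sub>A + \<beta>\<^sub>D"
      using that by (cases k) auto
    then show ?thesis
      using has_bandwidth_lyapunov[OF assms(1,3)] iterates[of "k - 1"]
      unfolding cg_W_def by metis
  qed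
  have "bandwidth T \<le> b" if "has_bandwidth T b" for T :: "real mat" and b
    unfolding bandwidth_def using that by (rule Least_le)
  then show ?thesis
    using iterates W unfolding banded_def by blast
qed

end
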